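(* Bishop Latin squares and king Latin squares exist for all even orders, and knight Latin squares exist for all orders divisible by four or five.
   Context: Orders are positive integers. A Latin square of order $n$ is an $n\times n$ table filled with the integers $1,\dots,n$ so that each integer appears exactly once in each row and in each column. A bishop (respectively king, knight) Latin square is a Latin square such that for each cell there is another cell containing the same number that is a bishop's (respectively king's, knight's) move apart. Moves are the usual chess moves with no wrap-around: two distinct cells are a bishop's move apart if they lie on a common diagonal (of either direction, at any distance), a king's move apart if they are horizontally, vertically or diagonally adjacent, and a knight's move apart if their row and column indices differ by $1$ and $2$ in absolute value, in some order. *)

theory Defs
  imports Main
begin

type_synonym cell = "nat \<times> nat"

definition cells :: "nat \<Rightarrow> cell set" where
  "cells n = {1..n} \<times> {1..n}"

text \<open>
  A table of order n is a function on pairs (row, column); its values outside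
  \<open>cells n\<close> are irrelevant.
\<close>

definition latin_square :: "nat \<Rightarrow> (cell \<Rightarrow> nat) \<Rightarrow> bool" where
  "latin_square n L \<longleftrightarrow>
     (\<forall>p \<in> cells n. L p \<in> {1..n}) \<and>
     (\<forall>r \<in> {1..n}. \<forall>s \<in> {1..n}. \<exists>!c. c \<in> {1..n} \<and> L (r, c) = s) \<and>
     (\<forall>c \<in> {1..n}. \<forall>s \<in> {1..n}. \<exists>!r. r \<in> {1..n} \<and> L (r, c) = s)"

definition row_dist :: "cell \<Rightarrow> cell \<Rightarrow> int" where
  "row_dist p q = \<bar>int (fst p) - int (fst q)\<bar>"

definition col_dist :: "cell \<Rightarrow> cell \<Rightarrow> int" where
  "col_dist p q = \<bar>int (snd p) - int (snd q)\<bar>"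

text \<open>
  Row minus column is constant on the diagonals of one direction, row plus column
  on those of the other. The subtraction is done in the integers because it
  truncates on the natural numbers.
\<close>

definition bishop_move :: "cell \<Rightarrow> cell \<Rightarrow> bool" where
  "bishop_move p q \<longleftrightarrow> p \<noteq> q \<and>
     (int (fst p) - int (snd p) = int (fst q) - int (snd q) \<or>
      fst p + snd p = fst q + snd q)"

definition king_move :: "cell \<Rightarrow> cell \<Rightarrow> bool" where
  "king_move p q \<longleftrightarrow> (row_dist p q, col_dist p q) \<in> {(0, 1), (1, 0), (1, 1)}"

definition knight_move :: "cell \<Rightarrow> cell \<Rightarrow> bool" where
  "knight_move p q \<longleftrightarrow> (row_dist p q, col_dist p q) \<in> {(1, 2), (2, 1)}"

definition move_latin_square ::
    "(cell \<Rightarrow> cell \<Rightarrow> bool) \<Rightarrow> nat \<Rightarrow> (cell \<Rightarrow> nat) \<Rightarrow> bool" where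
  "move_latin_square move n L \<longleftrightarrow>
     latin_square n L \<and>
     (\<forall>p \<in> cells n. \<exists>q \<in> cells n. q \<noteq> p \<and> L q = L p \<and> move p q)"

definition bishop_latin_square :: "nat \<Rightarrow> (cell \<Rightarrow> nat) \<Rightarrow> bool" where
  "bishop_latin_square = move_latin_square bishop_move"

definition king_latin_square :: "nat \<Rightarrow> (cell \<Rightarrow> nat) \<Rightarrow> bool" where
  "king_latin_square = move_latin_square king_move"

definition knight_latin_square :: "nat \<Rightarrow> (cell \<Rightarrow> nat) \<Rightarrow> bool" where
  "knight_latin_square = move_latin_square knight_move"

end

theory Submission
  imports Defs
begin

text \<open>
  A square of order \<open>k\<close> whose cells are all served by a translation invariant move can be
  blown up to order \<open>k * m\<close>: replace each entry of the cyclic Latin square of order \<open>m\<close> by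
  a copy of the small square on its own \<open>k\<close> symbols. The partner of a cell is found inside
  its block, so it suffices to treat the orders 2 (for bishops and kings), 4 and 5
  (for knights).
\<close>

text \<open>An injective self-map of a finite set is a bijection, so the unique-existence clauses
  reduce to injectivity of each row and column.\<close>

lemma latin_squareI:
  assumes range: "\<And>r c. r \<in> {1..n} \<Longrightarrow> c \<in> {1..n} \<Longrightarrow> L (r, c) \<in> {1..n}"
    and rows: "\<And>r. r \<in> {1..n} \<Longrightarrow> inj_on (\<lambda>c. L (r, c)) {1..n}"
    and cols: "\<And>c. c \<in> {1..n} \<Longrightarrow> inj_on (\<lambda>r. L (r, c)) {1..n}"
  shows "latin_square n L"
proof -
  have perm: "\<exists>!x. x \<in> {1..n} \<and> f x = s"
    if "inj_on f {1..n}" "f ` {1..n} \<subseteq> {1..n}" "s \<in> {1..n}" for f :: "nat \<Rightarrow> nat" and s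
  proof -
    have "f ` {1..n} = {1..n}"
      using that by (intro endo_inj_surj) auto
    then show ?thesis
      using that by (metis (no_types, lifting) imageE inj_onD)
  qed
  show ?thesis
    unfolding latin_square_def cells_def
  proof (intro conjI ballI)
    show "L p \<in> {1..n}" if "p \<in> {1..n} \<times> {1..n}" for p
      using that by (cases p) (simp only: mem_Times_iff fst_conv snd_conv range)
    show "\<exists>!c. c \<in> {1..n} \<and> L (r, c) = s" if "r \<in> {1..n}" "s \<in> {1..n}" for r s
      by (rule perm[OF rows[OF that(1)] image_subsetI that(2)]) (rule range[OF that(1)])
    show "\<exists>!r. r \<in> {1..n} \<and> L (r, c) = s" if "c \<in> {1..n}" "s \<in> {1..n}" for c s
      by (rule perm[OF cols[OF that(1)] image_subsetI that(2)]) (rule range[OF _ that(1)])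
  qed
qed

lemma latin_square_range:
  "latin_square n L \<Longrightarrow> r \<in> {1..n} \<Longrightarrow> c \<in> {1..n} \<Longrightarrow> L (r, c) \<in> {1..n}"
  by (auto simp: latin_square_def cells_def)

lemma latin_square_inj_row:
  assumes "latin_square n L" "r \<in> {1..n}"
  shows "inj_on (\<lambda>c. L (r, c)) {1..n}"
proof (rule inj_onI)
  fix x y assume "x \<in> {1..n}" "y \<in> {1..n}" "L (r, x) = L (r, y)"
  moreover have "\<exists>!c. c \<in> {1..n} \<and> L (r, c) = L (r, y)"
    using assms \<open>y \<in> {1..n}\<close> latin_square_range[OF assms \<open>y \<in> {1..n}\<close>]
    unfolding latin_square_def by blast
  ultimately show "x = y" by blast
qed

lemma latin_square_inj_col:
  assumes "latin_square n L" "c \<in> {1..n}"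
  shows "inj_on (\<lambda>r. L (r, c)) {1..n}"
proof (rule inj_onI)
  fix x y assume "x \<in> {1..n}" "y \<in> {1..n}" "L (x, c) = L (y, c)"
  moreover have "\<exists>!r. r \<in> {1..n} \<and> L (r, c) = L (y, c)"
    using assms \<open>y \<in> {1..n}\<close> latin_square_range[OF assms(1) \<open>y \<in> {1..n}\<close> assms(2)]
    unfolding latin_square_def by blast
  ultimately show "x = y" by blast
qed

text \<open>Indices are shifted to start at 0, so that \<open>div\<close> finds the block and
  \<open>mod\<close> the place in it. The multiple of \<open>k\<close> gives each symbol of the
  cyclic square its own batch of \<open>k\<close> consecutive symbols.\<close>

definition blow_up :: "nat \<Rightarrow> nat \<Rightarrow> (cell \<Rightarrow> nat) \<Rightarrow> cell \<Rightarrow> nat" where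
  "blow_up k m L = (\<lambda>(r, c).
     k * (((r - 1) div k + (c - 1) div k) mod m) + L ((r - 1) mod k + 1, (c - 1) mod k + 1))"

lemma blow_up_block:
  assumes "a \<in> {1..k}" "b \<in> {1..k}"
  shows "blow_up k m L (k * i + a, k * j + b) = k * ((i + j) mod m) + L (a, b)"
proof -
  \<comment> \<open>As \<open>a\<close> is at least 1, the truncated subtraction is exact and leaves
    the remainder \<open>a - 1\<close>, which is below \<open>k\<close>.\<close>
  have "(k * i + a - 1) div k = i \<and> (k * i + a - 1) mod k + 1 = a" if "a \<in> {1..k}" for i a
    using that by (cases a) auto
  then show ?thesis
    using assms by (simp add: blow_up_def)
qed

lemma block_coordinates:
  fixes k m r :: nat
  assumes "r \<in> {1..k * m}"
  obtains i a where "r = k * i + a" "i < m" "a \<in> {1..k}"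
proof
  from assms have "k > 0" by (cases k) auto
  show "r = k * ((r - 1) div k) + ((r - 1) mod k + 1)"
    using assms by simp
  show "(r - 1) div k < m"
    using assms by (intro less_mult_imp_div_less) (auto simp: mult.commute)
  show "(r - 1) mod k + 1 \<in> {1..k}"
    using \<open>k > 0\<close> by (auto simp: Suc_le_eq)
qed

lemma block_in_range:
  fixes k m i a :: nat
  assumes "i < m" "a \<in> {1..k}"
  shows "k * i + a \<in> {1..k * m}"
proof -
  have "k * i + a \<le> k * Suc i" using assms by simp
  also have "\<dots> \<le> k * m" using assms by (intro mult_le_mono2) simp
  finally show ?thesis using assms by simp
qed

text \<open>Uniqueness of base-\<open>k\<close> digits, with last digit in 1..k instead of 0..k-1.
  It splits an equality of symbols into equal batches and equal small symbols.\<close>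

lemma block_eq_iff:
  fixes k i j a b :: nat
  assumes "a \<in> {1..k}" "b \<in> {1..k}"
  shows "k * i + a = k * j + b \<longleftrightarrow> i = j \<and> a = b"
proof
  assume eq: "k * i + a = k * j + b"
  have "\<not> x < y" if "k * x + c = k * y + d" "c \<in> {1..k}" "d \<in> {1..k}" for x y c d :: nat
  proof
    assume "x < y"
    then have "k * Suc x \<le> k * y" by (intro mult_le_mono2) simp
    then show False using that by simp
  qed
  from this[OF eq assms] this[OF eq[symmetric] assms(2,1)] have "i = j" by simp
  then show "i = j \<and> a = b" using eq by simp
qed simp

text \<open>This is the Latin property of the cyclic square, \<open>l\<close> being the fixed row or
  column.\<close>

lemma add_mod_cancel_left:
  fixes i j l m :: nat
  assumes "(l + i) mod m = (l + j) mod m" "i < m" "j < m"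
  shows "i = j"
proof -
  have "y \<le> x" if "(l + x) mod m = (l + y) mod m" "y < m" for x y
  proof (rule ccontr)
    assume "\<not> y \<le> x"
    \<comment> \<open>A multiple of \<open>m\<close> strictly between 0 and \<open>m\<close> is
      impossible.\<close>
    with that(1) have "m dvd y - x"
      by (metis add_diff_cancel_left add_le_cancel_left mod_eq_dvd_iff_nat nat_le_linear)
    with \<open>\<not> y \<le> x\<close> \<open>y < m\<close> show False
      by (auto dest: dvd_imp_le)
  qed
  from this[of i j] this[of j i] assms show ?thesis by simp
qed

text \<open>Equal entries in a line agree in small symbol and in batch: the small square then fixes
  the place within the block, and the cyclic square fixes the block.\<close>

lemma latin_square_blow_up:
  assumes L: "latin_square k L"
  shows "latin_square (k * m) (blow_up k m L)"
proof (rule latin_squareI)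
  fix r c assume "r \<in> {1..k * m}" "c \<in> {1..k * m}"
  then obtain i a j b where rc: "r = k * i + a" "i < m" "a \<in> {1..k}"
    "c = k * j + b" "j < m" "b \<in> {1..k}"
    by (metis block_coordinates)
  \<comment> \<open>The symbol itself has block form, with block index \<open>(i + j) mod m\<close>,
    so \<open>block_in_range\<close> bounds it.\<close>
  then show "blow_up k m L (r, c) \<in> {1..k * m}"
    by (auto simp del: atLeastAtMost_iff One_nat_def
        simp: blow_up_block intro!: block_in_range latin_square_range[OF L])
next
  fix r assume "r \<in> {1..k * m}"
  then obtain i a where r: "r = k * i + a" "i < m" "a \<in> {1..k}"
    by (rule block_coordinates)
  show "inj_on (\<lambda>c. blow_up k m L (r, c)) {1..k * m}"
  proof (rule inj_onI)
    fix x y assume "x \<in> {1..k * m}" "y \<in> {1..k * m}"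
      and eq: "blow_up k m L (r, x) = blow_up k m L (r, y)"
    then obtain j b j' b' where xy: "x = k * j + b" "j < m" "b \<in> {1..k}"
      "y = k * j' + b'" "j' < m" "b' \<in> {1..k}"
      by (metis block_coordinates)
    from eq have "(i + j) mod m = (i + j') mod m \<and> L (a, b) = L (a, b')"
      unfolding r xy using r xy
      by (simp only: blow_up_block block_eq_iff latin_square_range[OF L])
    moreover from this have "b = b'"
      using inj_onD[OF latin_square_inj_row[OF L r(3)]] xy by blast
    ultimately show "x = y"
      using xy add_mod_cancel_left[of i j m j'] by simp
  qed
next
  fix c assume "c \<in> {1..k * m}"
  then obtain j b where c: "c = k * j + b" "j < m" "b \<in> {1..k}"
    by (rule block_coordinates)
  show "inj_on (\<lambda>r. blow_up k m L (r, c)) {1..k * m}"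
  proof (rule inj_onI)
    fix x y assume "x \<in> {1..k * m}" "y \<in> {1..k * m}"
      and eq: "blow_up k m L (x, c) = blow_up k m L (y, c)"
    then obtain i a i' a' where xy: "x = k * i + a" "i < m" "a \<in> {1..k}"
      "y = k * i' + a'" "i' < m" "a' \<in> {1..k}"
      by (metis block_coordinates)
    \<comment> \<open>The sums are commuted to put the fixed summand \<open>j\<close> first, as the
      cancellation lemma expects.\<close>
    from eq have "(j + i) mod m = (j + i') mod m \<and> L (a, b) = L (a', b)"
      unfolding c xy using c xy
      by (simp only: blow_up_block block_eq_iff latin_square_range[OF L] add.commute[of j])
    moreover from this have "a = a'"
      using inj_onD[OF latin_square_inj_col[OF L c(3)]] xy by blast
    ultimately show "x = y"
      using xy add_mod_cancel_left[of j i m i'] by simp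
  qed
qed

text \<open>Shifts by natural numbers suffice, since every block is such a shift of the corner
  block.\<close>

definition translation_invariant :: "(cell \<Rightarrow> cell \<Rightarrow> bool) \<Rightarrow> bool" where
  "translation_invariant move \<longleftrightarrow> (\<forall>a b a' b' x y.
     move (a, b) (a', b') \<longrightarrow> move (x + a, y + b) (x + a', y + b'))"

lemma move_latin_square_blow_up:
  assumes "translation_invariant move" "move_latin_square move k L"
  shows "move_latin_square move (k * m) (blow_up k m L)"
  unfolding move_latin_square_def
proof (intro conjI ballI)
  from assms have L: "latin_square k L"
    and partner: "\<And>p. p \<in> cells k \<Longrightarrow> \<exists>q \<in> cells k. q \<noteq> p \<and> L q = L p \<and> move p q"
    by (auto simp: move_latin_square_def)
  show "latin_square (k * m) (blow_up k m L)"
    using L by (rule latin_square_blow_up)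
  fix p assume "p \<in> cells (k * m)"
  then obtain r c where "p = (r, c)" "r \<in> {1..k * m}" "c \<in> {1..k * m}"
    by (auto simp: cells_def)
  then obtain i a j b where p: "p = (k * i + a, k * j + b)"
    and ij: "i < m" "j < m" and ab: "a \<in> {1..k}" "b \<in> {1..k}"
    by (metis block_coordinates)
  \<comment> \<open>The partner is chosen in the small square and shifted back into the same block,
    where the batch of symbols is unchanged.\<close>
  obtain a' b' where q: "a' \<in> {1..k}" "b' \<in> {1..k}" "(a', b') \<noteq> (a, b)"
      "L (a', b') = L (a, b)" "move (a, b) (a', b')"
    using partner[of "(a, b)"] ab by (auto simp: cells_def)
  show "\<exists>q \<in> cells (k * m). q \<noteq> p \<and> blow_up k m L q = blow_up k m L p \<and> move p q"
  proof (intro bexI conjI)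
    let ?q = "(k * i + a', k * j + b')"
    show "?q \<in> cells (k * m)"
      using block_in_range ij q by (simp add: cells_def del: atLeastAtMost_iff)
    show "?q \<noteq> p" using q p by auto
    show "blow_up k m L ?q = blow_up k m L p"
      using p q ab by (simp add: blow_up_block del: atLeastAtMost_iff)
    show "move p ?q"
      using p q assms(1) by (simp add: translation_invariant_def)
  qed
qed

lemma translation_invariant_moves:
  "translation_invariant bishop_move"
  "translation_invariant king_move"
  "translation_invariant knight_move"
  by (auto simp: translation_invariant_def bishop_move_def king_move_def knight_move_def
      row_dist_def col_dist_def)

text \<open>Each symbol fills one of the two diagonals, and diagonal neighbours are a bishop's and a
  king's move apart.\<close>

definition square2 :: "cell \<Rightarrow> nat" where
  "square2 = (\<lambda>(r, c). if r = c then 1 else 2)"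

text \<open>A Klein four-group table with its middle rows exchanged. Rows 2 and 4 are rows 1 and 3
  with their halves swapped, so equal entries in such a pair of rows lie two columns apart.\<close>

definition square4 :: "cell \<Rightarrow> nat" where
  "square4 = (\<lambda>(r, c). [[1,2,3,4], [3,4,1,2], [2,1,4,3], [4,3,2,1]] ! (r - 1) ! (c - 1))"

text \<open>
  The symbol classes are lattice cosets, and \<open>(1,2)\<close>, \<open>(-1,-2)\<close>, \<open>(2,-1)\<close>, \<open>(-2,1)\<close> lie
  in the lattice; each cell of the board can make at least one of these four moves.
\<close>

definition square5 :: "cell \<Rightarrow> nat" where
  "square5 = (\<lambda>(r, c). (c + 3 * r) mod 5 + 1)"

lemma small_intervals:
  "{1..2::nat} = {1, 2}" "{1..4::nat} = {1, 2, 3, 4}" "{1..5::nat} = {1, 2, 3, 4, 5}"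
  by auto

lemma move_latin_square2:
  "bishop_latin_square 2 square2" "king_latin_square 2 square2"
proof -
  have "latin_square 2 square2"
    by (rule latin_squareI; unfold small_intervals) (auto simp: square2_def)
  then show "bishop_latin_square 2 square2" "king_latin_square 2 square2"
    unfolding bishop_latin_square_def king_latin_square_def move_latin_square_def
      cells_def small_intervals
    by (auto simp: square2_def bishop_move_def king_move_def row_dist_def col_dist_def)
qed

lemma knight_latin_square4: "knight_latin_square 4 square4"
proof -
  have "latin_square 4 square4"
    by (rule latin_squareI; unfold small_intervals) (auto simp: square4_def)
  then show ?thesis
    unfolding knight_latin_square_def move_latin_square_def cells_def small_intervals
    by (simp add: square4_def knight_move_def row_dist_def col_dist_def)
qed

lemma knight_latin_square5: "knight_latin_square 5 square5"
proof -
  have "latin_square 5 square5"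
    by (rule latin_squareI; unfold small_intervals) (auto simp: square5_def)
  then show ?thesis
    unfolding knight_latin_square_def move_latin_square_def cells_def small_intervals
    by (simp add: square5_def knight_move_def row_dist_def col_dist_def)
qed

theorem corollary21:
  shows "(\<forall>n::nat. n > 0 \<and> 2 dvd n \<longrightarrow> (\<exists>L. bishop_latin_square n L))
       \<and> (\<forall>n::nat. n > 0 \<and> 2 dvd n \<longrightarrow> (\<exists>L. king_latin_square n L))
       \<and> (\<forall>n::nat. n > 0 \<and> (4 dvd n \<or> 5 dvd n) \<longrightarrow> (\<exists>L. knight_latin_square n L))"
  using move_latin_square2 knight_latin_square4 knight_latin_square5
  unfolding bishop_latin_square_def king_latin_square_def knight_latin_square_def
  \<comment> \<open>With \<open>n = k * m\<close> for \<open>k\<close> = 2, 4 or 5, the witness is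
    \<open>blow_up k m\<close> of the matching small square.\<close>
  by (blast elim!: dvdE intro: move_latin_square_blow_up translation_invariant_moves)

end
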